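(* Let $\alpha_1,\alpha_2,\alpha_3,\beta_1,\beta_2,\lambda_1$ be real parameters of a generalized quadratic number system $\mathfrak{Q}$ with associated coefficients $A,B,C,D,E,F$ (see context), and assume $\mathbf{M}_{\mathfrak{Q}}$ is non-degenerate. Let $\mathbf{v}=(x,y,z)\in\mathbb{R}^3$ and let $$\mathfrak{S}=\begin{bmatrix} -\alpha_1y-\beta_1z & \alpha_1x-\lambda_1z & \beta_1x+\lambda_1y \\ -\beta_2z-\alpha_2y & \alpha_2x+\beta_1z & \beta_2x-\beta_1y \\ \alpha_2z-\alpha_3y & \alpha_3x-\alpha_1z & \alpha_1y-\alpha_2x \end{bmatrix}.$$ If $\mathbf{v}$ is not a unit spacelike vector, then $I_3+\mathfrak{S}$ is invertible and $$\mathcal{R}_{\mathbf{v}}=(I_3-\mathfrak{S})(I_3+\mathfrak{S})^{-1}$$ is a quadratic rotation matrix with rotation axis $\mathbf{v}$. Explicitly, $\mathcal{R}_{\mathbf{v}}=\rho\,\mathcal{M}$, where $\rho=\dfrac{1}{\Delta\langle\mathbf{v},\mathbf{v}\rangle_{\mathfrak{Q}}-1}$ and $\mathcal{M}$ is the $3\times3$ matrix with entries $$\mathcal{M}_{11}=Ax^2-By^2-Cz^2-2Fyz-2z\beta_1-2y\alpha_1-1,$$ $$\mathcal{M}_{12}=2(Fxz+Bxy+Dx^2+x\alpha_1-z\lambda_1),\qquad \mathcal{M}_{13}=2(Ex^2+Fxy+Cxz+x\beta_1+y\lambda_1),$$ $$\mathcal{M}_{21}=2(Axy+Dy^2+Eyz-z\beta_2-y\alpha_2),$$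 $$\mathcal{M}_{22}=-Ax^2+By^2-Cz^2-2Exz+2z\beta_1+2x\alpha_2-1,\qquad \mathcal{M}_{23}=2(Fy^2+Exy+Cyz+x\beta_2-y\beta_1),$$ $$\mathcal{M}_{31}=2(Axz+Ez^2+Dyz+z\alpha_2-y\alpha_3),\qquad \mathcal{M}_{32}=2(Fz^2+Dxz+Byz+x\alpha_3-z\alpha_1),$$ $$\mathcal{M}_{33}=-Ax^2-By^2+Cz^2-2Dxy+2y\alpha_1-2x\alpha_2-1.$$
   Context: Given real numbers $\alpha_1,\alpha_2,\alpha_3,\beta_1,\beta_2,\lambda_1$ (the parameters of a generalized quadratic number system $\mathfrak{Q}$), put $$A=\alpha_2^2+\alpha_3\beta_2,\quad B=\alpha_1^2-\lambda_1\alpha_3,\quad C=\beta_1^2+\lambda_1\beta_2,$$ $$D=-(\alpha_1\alpha_2+\alpha_3\beta_1),\quad E=\alpha_2\beta_1-\beta_2\alpha_1,\quad F=\alpha_1\beta_1+\lambda_1\alpha_2,$$ $$\mathbf{M}_{\mathfrak{Q}}=\begin{bmatrix} A & D & E \\ D & B & F \\ E & F & C \end{bmatrix}.$$ The system is of ellipsoid type if $-\mathbf{M}_{\mathfrak{Q}}$ is positive definite (put $\Delta=-1$), and of indefinite type if $\mathbf{M}_{\mathfrak{Q}}$ is indefinite (and non-degenerate) (put $\Delta=1$). Put $\mathfrak{M}_{\mathfrak{Q}}=\Delta\mathbf{M}_{\mathfrak{Q}}$ and $\langle\mathbf{u},\mathbf{w}\rangle_{\mathfrak{Q}}=\mathbf{u}^T\mathfrak{M}_{\mathfrak{Q}}\mathbf{w}$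 for $\mathbf{u},\mathbf{w}\in\mathbb{R}^3$. Thus, for $\mathbf{v}=(x,y,z)$, $\Delta\langle\mathbf{v},\mathbf{v}\rangle_{\mathfrak{Q}}=Ax^2+By^2+Cz^2+2Dxy+2Exz+2Fyz$. In the indefinite case $\mathbf{v}$ is a unit spacelike vector if $Ax^2+By^2+Cz^2+2Dxy+2Exz+2Fyz=1$; in the ellipsoid case there are no spacelike vectors. A quadratic rotation matrix is a real $3\times3$ matrix $R$ with $R^T\mathfrak{M}_{\mathfrak{Q}}R=\mathfrak{M}_{\mathfrak{Q}}$ and $\det R=1$; $\mathbf{v}$ is its rotation axis if $R\mathbf{v}=\mathbf{v}$. $I_3$ is the $3\times3$ identity matrix. *)

theory Defs
  imports "HOL-Analysis.Analysis"
begin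

record gq_system =
  alpha1 :: real
  alpha2 :: real
  alpha3 :: real
  beta1 :: real
  beta2 :: real
  lambda1 :: real

definition coeff_A :: "gq_system \<Rightarrow> real" where
  "coeff_A Q = (alpha2 Q)\<^sup>2 + alpha3 Q * beta2 Q"

definition coeff_B :: "gq_system \<Rightarrow> real" where
  "coeff_B Q = (alpha1 Q)\<^sup>2 - lambda1 Q * alpha3 Q"

definition coeff_C :: "gq_system \<Rightarrow> real" where
  "coeff_C Q = (beta1 Q)\<^sup>2 + lambda1 Q * beta2 Q"

definition coeff_D :: "gq_system \<Rightarrow> real" where
  "coeff_D Q = - (alpha1 Q * alpha2 Q + alpha3 Q * beta1 Q)"

definition coeff_E :: "gq_system \<Rightarrow> real" where
  "coeff_E Q = alpha2 Q * beta1 Q - beta2 Q * alpha1 Q"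

definition coeff_F :: "gq_system \<Rightarrow> real" where
  "coeff_F Q = alpha1 Q * beta1 Q + lambda1 Q * alpha2 Q"

definition M_mat :: "gq_system \<Rightarrow> real^3^3" where
  "M_mat Q = vector
     [vector [coeff_A Q, coeff_D Q, coeff_E Q],
      vector [coeff_D Q, coeff_B Q, coeff_F Q],
      vector [coeff_E Q, coeff_F Q, coeff_C Q]]"

definition non_degenerate :: "gq_system \<Rightarrow> bool" where
  "non_degenerate Q \<longleftrightarrow> det (M_mat Q) \<noteq> 0"

text \<open>The matrices below are symmetric by construction, so symmetry is not part of the predicates.\<close>

definition positive_definite :: "real^3^3 \<Rightarrow> bool" where
  "positive_definite X \<longleftrightarrow> (\<forall>u. u \<noteq> 0 \<longrightarrow> u \<bullet> (X *v u) > 0)"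

definition indefinite :: "real^3^3 \<Rightarrow> bool" where
  "indefinite X \<longleftrightarrow> (\<exists>u. u \<bullet> (X *v u) > 0) \<and> (\<exists>w. w \<bullet> (X *v w) < 0)"

definition ellipsoid_type :: "gq_system \<Rightarrow> bool" where
  "ellipsoid_type Q \<longleftrightarrow> positive_definite (- M_mat Q)"

definition indefinite_type :: "gq_system \<Rightarrow> bool" where
  "indefinite_type Q \<longleftrightarrow> indefinite (M_mat Q) \<and> non_degenerate Q"

text \<open>
  \<^term>\<open>M_mat Q\<close> is minus the adjugate of a symmetric matrix, so its determinant is minus a
  square. Hence a non-degenerate system is either of ellipsoid or of indefinite type, and for
  such systems the second branch below is exactly the indefinite case.
\<close>

definition Delta :: "gq_system \<Rightarrow> real" where
  "Delta Q = (if ellipsoid_type Q then - 1 else 1)"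

definition gram_mat :: "gq_system \<Rightarrow> real^3^3" where
  "gram_mat Q = Delta Q *\<^sub>R M_mat Q"

definition inner_Q :: "gq_system \<Rightarrow> real^3 \<Rightarrow> real^3 \<Rightarrow> real" where
  "inner_Q Q u w = u \<bullet> (gram_mat Q *v w)"

definition unit_spacelike :: "gq_system \<Rightarrow> real^3 \<Rightarrow> bool" where
  "unit_spacelike Q v \<longleftrightarrow> indefinite_type Q \<and>
     coeff_A Q * (v$1)\<^sup>2 + coeff_B Q * (v$2)\<^sup>2 + coeff_C Q * (v$3)\<^sup>2
     + 2 * coeff_D Q * v$1 * v$2 + 2 * coeff_E Q * v$1 * v$3 + 2 * coeff_F Q * v$2 * v$3 = 1"

definition quadratic_rotation :: "gq_system \<Rightarrow> real^3^3 \<Rightarrow> bool" where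
  "quadratic_rotation Q R \<longleftrightarrow> transpose R ** gram_mat Q ** R = gram_mat Q \<and> det R = 1"

definition rotation_axis :: "real^3^3 \<Rightarrow> real^3 \<Rightarrow> bool" where
  "rotation_axis R v \<longleftrightarrow> R *v v = v"

definition S_mat :: "gq_system \<Rightarrow> real^3 \<Rightarrow> real^3^3" where
  "S_mat Q v =
    (let x = v$1; y = v$2; z = v$3;
         a1 = alpha1 Q; a2 = alpha2 Q; a3 = alpha3 Q;
         b1 = beta1 Q; b2 = beta2 Q; l1 = lambda1 Q
     in vector
       [vector [- a1*y - b1*z, a1*x - l1*z, b1*x + l1*y],
        vector [- b2*z - a2*y, a2*x + b1*z, b2*x - b1*y],
        vector [a2*z - a3*y, a3*x - a1*z, a1*y - a2*x]])"

definition cayley_rotation :: "gq_system \<Rightarrow> real^3 \<Rightarrow> real^3^3" where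
  "cayley_rotation Q v = (mat 1 - S_mat Q v) ** matrix_inv (mat 1 + S_mat Q v)"

definition explicit_mat :: "gq_system \<Rightarrow> real^3 \<Rightarrow> real^3^3" where
  "explicit_mat Q v =
    (let x = v$1; y = v$2; z = v$3;
         a1 = alpha1 Q; a2 = alpha2 Q; a3 = alpha3 Q;
         b1 = beta1 Q; b2 = beta2 Q; l1 = lambda1 Q;
         A = coeff_A Q; B = coeff_B Q; C = coeff_C Q;
         D = coeff_D Q; E = coeff_E Q; F = coeff_F Q
     in vector
       [vector
         [A*x\<^sup>2 - B*y\<^sup>2 - C*z\<^sup>2 - 2*F*y*z - 2*z*b1 - 2*y*a1 - 1,
          2*(F*x*z + B*x*y + D*x\<^sup>2 + x*a1 - z*l1),
          2*(E*x\<^sup>2 + F*x*y + C*x*z + x*b1 + y*l1)],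
        vector
         [2*(A*x*y + D*y\<^sup>2 + E*y*z - z*b2 - y*a2),
          - A*x\<^sup>2 + B*y\<^sup>2 - C*z\<^sup>2 - 2*E*x*z + 2*z*b1 + 2*x*a2 - 1,
          2*(F*y\<^sup>2 + E*x*y + C*y*z + x*b2 - y*b1)],
        vector
         [2*(A*x*z + E*z\<^sup>2 + D*y*z + z*a2 - y*a3),
          2*(F*z\<^sup>2 + D*x*z + B*y*z + x*a3 - z*a1),
          - A*x\<^sup>2 - B*y\<^sup>2 + C*z\<^sup>2 - 2*D*x*y + 2*y*a1 - 2*x*a2 - 1]])"

end

theory Submission
  imports Defs
begin

text \<open>
  \<open>S\<close> is singular with trace zero and second invariant \<open>- q\<close>, where \<open>q\<close> is the value at \<open>v\<close> of the
  quadratic form of \<open>M\<close>, so \<open>det (I + S) = det (I - S) = 1 - q\<close>. As \<open>S\<close> is skew with respect to \<open>M\<close>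
  and \<open>S v = 0\<close>, the Cayley transform of \<open>S\<close> preserves \<open>M\<close> and fixes \<open>v\<close>. The value \<open>q = 1\<close> occurs
  only for systems of indefinite type: \<open>det M\<close> is minus a nonzero square, whereas the determinant
  of a positive semidefinite form is nonnegative.
\<close>

lemma nonneg_binary_form_imp:
  fixes a b c :: real
  assumes nonneg: "\<And>s t. 0 \<le> a * s\<^sup>2 + b * t\<^sup>2 + 2 * c * s * t"
  shows "0 \<le> a" and "0 \<le> b" and "c\<^sup>2 \<le> a * b"
proof -
  show a: "0 \<le> a" using nonneg[of 1 0] by simp
  show b: "0 \<le> b" using nonneg[of 0 1] by simp
  show "c\<^sup>2 \<le> a * b"
  proof (cases "a = 0")
    case True
    \<comment> \<open>For \<open>a = 0\<close> the form takes the value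
      \<open>- (b + 2) * c\<^sup>2\<close> at this pair.\<close>
    have "(b + 2) * c\<^sup>2 \<le> 0"
      using nonneg[of "- (b + 1)" c] True by (simp add: algebra_simps power2_eq_square)
    with b have "c\<^sup>2 \<le> 0" by (simp add: mult_le_0_iff)
    with True show ?thesis by simp
  next
    case False
    \<comment> \<open>The pair \<open>(- c, a)\<close> is orthogonal to \<open>(1, 0)\<close> under
      the form.\<close>
    have "0 \<le> a * (a * b - c\<^sup>2)"
      using nonneg[of "- c" a] by (simp add: algebra_simps power2_eq_square)
    with a False show ?thesis by (simp add: zero_le_mult_iff)
  qed
qed

lemma nonneg_ternary_form_det_nonneg:
  fixes a b c d e f :: real
  assumes nonneg: "\<And>x y z. 0 \<le> a * x\<^sup>2 + b * y\<^sup>2 + c * z\<^sup>2 + 2 * d * x * y + 2 * e * x * z + 2 * f * y * z"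
  shows "0 \<le> a * b * c + 2 * d * e * f - a * f\<^sup>2 - b * e\<^sup>2 - c * d\<^sup>2"
proof (rule ccontr)
  define \<delta> where "\<delta> = a * b * c + 2 * d * e * f - a * f\<^sup>2 - b * e\<^sup>2 - c * d\<^sup>2"
  assume "\<not> 0 \<le> a * b * c + 2 * d * e * f - a * f\<^sup>2 - b * e\<^sup>2 - c * d\<^sup>2"
  then have neg: "\<delta> < 0" by (simp add: \<delta>_def)
  define a' b' c' d' e' f'
    where adj: "a' = b * c - f\<^sup>2" "b' = a * c - e\<^sup>2" "c' = a * b - d\<^sup>2"
      "d' = e * f - c * d" "e' = d * f - b * e" "f' = d * e - a * f"
  have minors: "0 \<le> a'" "0 \<le> b'" "0 \<le> c'"
    using nonneg_binary_form_imp(3)[of b c f] nonneg[of 0]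
      nonneg_binary_form_imp(3)[of a c e] nonneg[of _ 0]
      nonneg_binary_form_imp(3)[of a b d] nonneg[of _ _ 0]
    by (simp_all add: adj)
  \<comment> \<open>The form evaluated at the image of \<open>(x, y, z)\<close> under the adjugate is \<open>\<delta>\<close> times the form of the
    adjugate, so the latter is nonpositive, although its diagonal is nonnegative.\<close>
  have "0 \<le> \<delta> * (a' * x\<^sup>2 + b' * y\<^sup>2 + c' * z\<^sup>2 + 2 * d' * x * y + 2 * e' * x * z + 2 * f' * y * z)"
    for x y z
  proof -
    have "\<delta> * (a' * x\<^sup>2 + b' * y\<^sup>2 + c' * z\<^sup>2 + 2 * d' * x * y + 2 * e' * x * z + 2 * f' * y * z)
      = a * (a' * x + d' * y + e' * z)\<^sup>2 + b * (d' * x + b' * y + f' * z)\<^sup>2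
        + c * (e' * x + f' * y + c' * z)\<^sup>2
        + 2 * d * (a' * x + d' * y + e' * z) * (d' * x + b' * y + f' * z)
        + 2 * e * (a' * x + d' * y + e' * z) * (e' * x + f' * y + c' * z)
        + 2 * f * (d' * x + b' * y + f' * z) * (e' * x + f' * y + c' * z)"
      unfolding \<delta>_def adj by algebra
    then show ?thesis using nonneg by simp
  qed
  then have adj_nonneg: "0 \<le> (- a') * x\<^sup>2 + (- b') * y\<^sup>2 + (- c') * z\<^sup>2
      + 2 * (- d') * x * y + 2 * (- e') * x * z + 2 * (- f') * y * z" for x y z
    using neg by (simp add: zero_le_mult_iff) (smt (verit, best))
  have "d'\<^sup>2 \<le> a' * b'" "e'\<^sup>2 \<le> a' * c'" "f'\<^sup>2 \<le> b' * c'" "a' \<le> 0" "b' \<le> 0" "c' \<le> 0"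
    using nonneg_binary_form_imp[of "- a'" "- b'" "- d'"] adj_nonneg[of _ _ 0]
      nonneg_binary_form_imp[of "- a'" "- c'" "- e'"] adj_nonneg[of _ 0]
      nonneg_binary_form_imp[of "- b'" "- c'" "- f'"] adj_nonneg[of 0]
    by simp_all
  \<comment> \<open>Once \<open>a'\<close> is 0, the minor bounds force \<open>d'\<close> and
    \<open>e'\<close> to vanish; expanding \<delta> along the first row then gives 0.\<close>
  with minors have "a' = 0" "d' = 0" "e' = 0" by simp_all
  moreover have "\<delta> = a * a' + d * d' + e * e'"
    unfolding \<delta>_def adj by algebra
  ultimately show False using neg by simp
qed

lemma vec3_eq_iff:
  fixes u w :: "'a^3"
  shows "u = w \<longleftrightarrow> u$1 = w$1 \<and> u$2 = w$2 \<and> u$3 = w$3"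
  by (simp add: vec_eq_iff forall_3)

lemma mat3_entries:
  fixes X Y :: "'a::comm_ring_1^3^3" and u :: "'a^3"
  shows "(X ** Y)$i$j = X$i$1 * Y$1$j + X$i$2 * Y$2$j + X$i$3 * Y$3$j"
    and "(X *v u)$i = X$i$1 * u$1 + X$i$2 * u$2 + X$i$3 * u$3"
  by (simp_all add: matrix_matrix_mult_def matrix_vector_mult_def sum_3)

lemma matrix_mul_inv:
  fixes X :: "'a::semiring_1^'n^'n"
  assumes "invertible X"
  shows "X ** matrix_inv X = mat 1" and "matrix_inv X ** X = mat 1"
  using someI_ex[OF assms[unfolded invertible_def]] by (simp_all add: matrix_inv_def)

lemma matrix_add_rdistrib: "(X + Y) ** Z = X ** Z + Y ** Z"
  by (simp add: matrix_matrix_mult_def vec_eq_iff sum.distrib distrib_right)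

lemma matrix_sub_ldistrib:
  fixes X :: "'a::ring_1^'n^'m"
  shows "X ** (Y - Z) = X ** Y - X ** Z"
  by (simp add: matrix_matrix_mult_def vec_eq_iff sum_subtractf right_diff_distrib)

lemma matrix_sub_rdistrib:
  fixes X :: "'a::ring_1^'n^'m"
  shows "(X - Y) ** Z = X ** Z - Y ** Z"
  by (simp add: matrix_matrix_mult_def vec_eq_iff sum_subtractf left_diff_distrib)

lemma transpose_add: "transpose (X + Y) = transpose X + transpose Y"
  by (simp add: transpose_def vec_eq_iff)

lemma transpose_diff: "transpose (X - Y) = transpose X - transpose Y"
  by (simp add: transpose_def vec_eq_iff)

text \<open>Moving \<open>M\<close> past a transposed factor swaps \<open>mat 1 - S\<close> and
  \<open>mat 1 + S\<close>. As these commute, both pull \<open>M\<close> back to the same matrix,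
  and the inverse cancels.\<close>

lemma cayley_preserves_form:
  fixes S M :: "real^'n^'n"
  assumes skew: "transpose S ** M = - (M ** S)" and inv: "invertible (mat 1 + S)"
  defines "R \<equiv> (mat 1 - S) ** matrix_inv (mat 1 + S)"
  shows "transpose R ** M ** R = M"
proof -
  let ?P = "mat 1 + S" and ?N = "mat 1 - S"
  have "transpose ?N ** M = M ** ?P" "transpose ?P ** M = M ** ?N"
    using skew by (simp_all add: transpose_diff transpose_add matrix_add_ldistrib
        matrix_add_rdistrib matrix_sub_ldistrib matrix_sub_rdistrib)
  moreover have "?P ** ?N = ?N ** ?P"
    by (simp add: matrix_add_ldistrib matrix_add_rdistrib matrix_sub_ldistrib matrix_sub_rdistrib)
  ultimately have eq: "transpose ?N ** M ** ?N = transpose ?P ** M ** ?P"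
    by (metis matrix_mul_assoc)
  have "transpose R ** M ** R
      = transpose (matrix_inv ?P) ** (transpose ?N ** M ** ?N) ** matrix_inv ?P"
    by (simp add: R_def matrix_transpose_mul matrix_mul_assoc)
  also have "\<dots> = transpose (?P ** matrix_inv ?P) ** M ** (?P ** matrix_inv ?P)"
    unfolding eq by (simp add: matrix_transpose_mul matrix_mul_assoc)
  also have "\<dots> = M" by (simp add: matrix_mul_inv[OF inv] transpose_mat)
  finally show ?thesis .
qed

definition quad_form :: "gq_system \<Rightarrow> real^3 \<Rightarrow> real" where
  "quad_form Q v = v \<bullet> (M_mat Q *v v)"

lemmas coeff_defs = coeff_A_def coeff_B_def coeff_C_def coeff_D_def coeff_E_def coeff_F_def

lemma quad_form_expand:
  "quad_form Q v = coeff_A Q * (v$1)\<^sup>2 + coeff_B Q * (v$2)\<^sup>2 + coeff_C Q * (v$3)\<^sup>2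
     + 2 * coeff_D Q * v$1 * v$2 + 2 * coeff_E Q * v$1 * v$3 + 2 * coeff_F Q * v$2 * v$3"
  by (simp add: quad_form_def M_mat_def inner_vec_def sum_3 mat3_entries algebra_simps power2_eq_square)

text \<open>The sign occurs both as the factor and inside \<open>gram_mat\<close>, and it squares to
  1.\<close>

lemma Delta_inner_Q: "Delta Q * inner_Q Q v v = quad_form Q v"
  by (simp add: inner_Q_def gram_mat_def quad_form_def Delta_def scaleR_matrix_vector_assoc[symmetric])

lemma det_M_mat_expand:
  "det (M_mat Q) = coeff_A Q * coeff_B Q * coeff_C Q + 2 * coeff_D Q * coeff_E Q * coeff_F Q
     - coeff_A Q * (coeff_F Q)\<^sup>2 - coeff_B Q * (coeff_E Q)\<^sup>2 - coeff_C Q * (coeff_D Q)\<^sup>2"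
  by (simp add: det_3 M_mat_def algebra_simps power2_eq_square)

text \<open>\<^term>\<open>M_mat Q\<close> is minus the adjugate of the symmetric matrix with diagonal
  \<open>\<lambda>\<^sub>1, - \<beta>\<^sub>2, \<alpha>\<^sub>3\<close>, whose determinant is squared here.\<close>

lemma det_M_mat_nonpos: "det (M_mat Q) \<le> 0"
proof -
  have "det (M_mat Q) = - (alpha3 Q * ((beta1 Q)\<^sup>2 + lambda1 Q * beta2 Q)
      + lambda1 Q * (alpha2 Q)\<^sup>2 + 2 * alpha1 Q * alpha2 Q * beta1 Q - (alpha1 Q)\<^sup>2 * beta2 Q)\<^sup>2"
    unfolding det_M_mat_expand coeff_defs by algebra
  then show ?thesis by simp
qed

text \<open>A nonnegative form would have determinant at least 0, which together with
  \<open>det_M_mat_nonpos\<close> makes it 0.\<close>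

lemma non_degenerate_quad_form_neg:
  assumes "non_degenerate Q"
  obtains w where "quad_form Q w < 0"
proof (rule ccontr)
  assume "\<not> thesis"
  with that have nonneg: "0 \<le> quad_form Q w" for w by (meson not_le)
  have "0 \<le> det (M_mat Q)"
    unfolding det_M_mat_expand
  proof (rule nonneg_ternary_form_det_nonneg)
    show "0 \<le> coeff_A Q * x\<^sup>2 + coeff_B Q * y\<^sup>2 + coeff_C Q * z\<^sup>2
      + 2 * coeff_D Q * x * y + 2 * coeff_E Q * x * z + 2 * coeff_F Q * y * z" for x y z
      using nonneg[of "vector [x, y, z]"] by (simp add: quad_form_expand)
  qed
  with det_M_mat_nonpos[of Q] assms show False by (simp add: non_degenerate_def)
qed

lemma quad_form_ne_1:
  assumes "non_degenerate Q" and "\<not> unit_spacelike Q v"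
  shows "quad_form Q v \<noteq> 1"
proof
  assume q: "quad_form Q v = 1"
  obtain w where "quad_form Q w < 0" using non_degenerate_quad_form_neg[OF assms(1)] .
  with q have "indefinite (M_mat Q)"
    unfolding indefinite_def quad_form_def by (metis zero_less_one)
  with q assms show False
    by (simp add: unit_spacelike_def indefinite_type_def quad_form_expand)
qed

lemma det_mat_1_plus_S_mat: "det (mat 1 + S_mat Q v) = 1 - quad_form Q v"
  unfolding det_3 quad_form_expand coeff_defs
  by (simp add: S_mat_def Let_def mat_def) algebra

text \<open>\<open>S_mat Q v\<close> is linear in \<open>v\<close> and the form is even, so this is
  the previous identity at \<open>- v\<close>.\<close>

lemma det_mat_1_minus_S_mat: "det (mat 1 - S_mat Q v) = 1 - quad_form Q v"
  unfolding det_3 quad_form_expand coeff_defs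
  by (simp add: S_mat_def Let_def mat_def) algebra

text \<open>\<open>S_mat Q v\<close> is N times the matrix of the cross product with
  \<open>v\<close>, where N is the symmetric matrix whose adjugate is \<open>- M_mat Q\<close>; and
  the cross product of \<open>v\<close> with itself is 0.\<close>

lemma S_mat_axis: "S_mat Q v *v v = 0"
  by (simp add: vec3_eq_iff mat3_entries S_mat_def Let_def algebra_simps)

text \<open>By the same factorization \<open>M_mat Q ** S_mat Q v\<close> is - det N times the
  antisymmetric cross product matrix, and \<open>M_mat Q\<close> is symmetric.\<close>

lemma S_mat_skew: "transpose (S_mat Q v) ** M_mat Q = - (M_mat Q ** S_mat Q v)"
  unfolding vec3_eq_iff
  by (simp add: mat3_entries transpose_def S_mat_def M_mat_def Let_def coeff_defs
      algebra_simps power2_eq_square)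

text \<open>The explicit formula with inverse and denominator cleared, so that it becomes a
  polynomial identity checked entry by entry.\<close>

lemma explicit_mat_mult:
  "explicit_mat Q v ** (mat 1 + S_mat Q v) = (quad_form Q v - 1) *\<^sub>R (mat 1 - S_mat Q v)"
  unfolding vec3_eq_iff quad_form_expand
  by (simp add: mat3_entries explicit_mat_def S_mat_def Let_def coeff_defs mat_def
      algebra_simps power2_eq_square)

theorem theorem19:
  fixes Q :: gq_system and v :: "real^3"
  assumes "non_degenerate Q"
    and "\<not> unit_spacelike Q v"
  shows "invertible (mat 1 + S_mat Q v)
    \<and> quadratic_rotation Q (cayley_rotation Q v)
    \<and> rotation_axis (cayley_rotation Q v) v
    \<and> Delta Q * inner_Q Q v v - 1 \<noteq> 0
    \<and> cayley_rotation Q v = (1 / (Delta Q * inner_Q Q v v - 1)) *\<^sub>R explicit_mat Q v"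
proof -
  let ?P = "mat 1 + S_mat Q v" and ?N = "mat 1 - S_mat Q v" and ?q = "quad_form Q v"
  have q: "?q \<noteq> 1" using quad_form_ne_1[OF assms] .
  have inv: "invertible ?P"
    using q by (simp add: invertible_det_nz det_mat_1_plus_S_mat)
  note P = matrix_mul_inv[OF inv]
  have "transpose (cayley_rotation Q v) ** M_mat Q ** cayley_rotation Q v = M_mat Q"
    unfolding cayley_rotation_def by (rule cayley_preserves_form[OF S_mat_skew inv])
  then have "transpose (cayley_rotation Q v) ** gram_mat Q ** cayley_rotation Q v = gram_mat Q"
    by (simp add: gram_mat_def matrix_scalar_ac scalar_matrix_assoc[symmetric])
  moreover have "det (cayley_rotation Q v) = 1"
  proof -
    have "det ?P * det (matrix_inv ?P) = 1"
      by (metis P(1) det_mul det_I)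
    then show ?thesis
      by (simp add: cayley_rotation_def det_mul det_mat_1_plus_S_mat det_mat_1_minus_S_mat)
  qed
  moreover have "cayley_rotation Q v *v v = v"
  proof -
    have "?P *v v = v" "?N *v v = v"
      by (simp_all add: matrix_vector_mult_add_rdistrib matrix_vector_mult_diff_rdistrib S_mat_axis)
    then show ?thesis
      unfolding cayley_rotation_def
      by (metis P(2) matrix_vector_mul_assoc matrix_vector_mul_lid)
  qed
  moreover have "cayley_rotation Q v = (1 / (?q - 1)) *\<^sub>R explicit_mat Q v"
  proof -
    \<comment> \<open>Inserting the identity in this form brings in the product evaluated by
      \<open>explicit_mat_mult\<close>.\<close>
    have "explicit_mat Q v = explicit_mat Q v ** (?P ** matrix_inv ?P)"
      by (simp add: P)
    also have "\<dots> = (?q - 1) *\<^sub>R cayley_rotation Q v"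
      unfolding matrix_mul_assoc explicit_mat_mult cayley_rotation_def
      by (simp add: scalar_matrix_assoc)
    finally show ?thesis using q by simp
  qed
  ultimately show ?thesis
    using q inv by (simp add: quadratic_rotation_def rotation_axis_def Delta_inner_Q)
qed

end
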